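(* Let $A,N_1,\dots,N_m\in\mathbb{R}^{n\times n}$ be symmetric with $A\prec 0$, let $B\in\mathbb{R}^{n\times r}$, and assume $\rho(\mathscr{L}^{-1}\Pi)<1$. Consider a sequence of approximations constructed as $$\hat X_0=0,\qquad \hat X_{k+1}=\hat X_k+v_{k+1}v_{k+1}^T,\quad k=0,1,\dots,$$ where, with $\mathcal{R}_k:=\mathscr{L}(\hat X_k)+\Pi(\hat X_k)+BB^T$, the vector $v_{k+1}\in\mathbb{R}^n$ is locally optimal, i.e. $(v_{k+1},v_{k+1})$ is a local minimizer of $$J_k(v,w):=\langle vw^T,vw^T\rangle_{\mathcal{M}}-2\,\mathrm{trace}(wv^T\mathcal{R}_k)$$ over $(v,w)\in\mathbb{R}^n\times\mathbb{R}^n$. Then $\mathcal{R}_k=\mathcal{R}_k^T\succeq 0$ for all $k\ge 0$.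
   Context: For $X\in\mathbb{R}^{n\times n}$: $\mathscr{L}(X):=AX+XA^T$, $\Pi(X):=\sum_{i=1}^m N_iXN_i^T$, $\mathcal{M}(X):=-\mathscr{L}(X)-\Pi(X)$, and $\langle X,Y\rangle_{\mathcal{M}}:=\mathrm{trace}(X^T\mathcal{M}(Y))$. $\rho$ denotes the spectral radius of a linear operator on $\mathbb{R}^{n\times n}$. The orderings $\prec,\succeq$ are the Loewner ordering on symmetric matrices. The matrix $\mathcal{R}_k$ is the residual of $\hat X_k$ for the symmetric generalized Lyapunov equation $\mathscr{L}(X)+\Pi(X)+BB^T=0$. *)

theory Defs
  imports "HOL-Analysis.Analysis"
begin

definition symmetric_matrix :: "real^'n^'n \<Rightarrow> bool" where
  "symmetric_matrix X \<longleftrightarrow> transpose X = X"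

(* The Loewner ordering relates symmetric matrices only, so symmetry of both
   arguments is part of the relations. *)

definition loewner_le :: "real^'n^'n \<Rightarrow> real^'n^'n \<Rightarrow> bool" where
  "loewner_le X Y \<longleftrightarrow> symmetric_matrix X \<and> symmetric_matrix Y \<and>
     (\<forall>x. 0 \<le> x \<bullet> ((Y - X) *v x))"

definition loewner_less :: "real^'n^'n \<Rightarrow> real^'n^'n \<Rightarrow> bool" where
  "loewner_less X Y \<longleftrightarrow> symmetric_matrix X \<and> symmetric_matrix Y \<and>
     (\<forall>x. x \<noteq> 0 \<longrightarrow> 0 < x \<bullet> ((Y - X) *v x))"

definition outer :: "real^'n \<Rightarrow> real^'n \<Rightarrow> real^'n^'n" where
  "outer v w = (\<chi> i j. v $ i * w $ j)"

lemma outer_eq_column_row: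
  "outer v w = (columnvector v :: real^1^'n) ** (rowvector w :: real^'n^1)"
  by (simp add: outer_def columnvector_def rowvector_def matrix_matrix_mult_def)

definition lyap :: "real^'n^'n \<Rightarrow> real^'n^'n \<Rightarrow> real^'n^'n" where
  "lyap A X = A ** X + X ** transpose A"

definition Pi_op :: "nat \<Rightarrow> (nat \<Rightarrow> real^'n^'n) \<Rightarrow> real^'n^'n \<Rightarrow> real^'n^'n" where
  "Pi_op m N X = (\<Sum>i=1..m. N i ** X ** transpose (N i))"

definition M_op :: "real^'n^'n \<Rightarrow> nat \<Rightarrow> (nat \<Rightarrow> real^'n^'n) \<Rightarrow> real^'n^'n \<Rightarrow> real^'n^'n" where
  "M_op A m N X = - lyap A X - Pi_op m N X"

definition M_inner ::
  "real^'n^'n \<Rightarrow> nat \<Rightarrow> (nat \<Rightarrow> real^'n^'n) \<Rightarrow> real^'n^'n \<Rightarrow> real^'n^'n \<Rightarrow> real" where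
  "M_inner A m N X Y = trace (transpose X ** M_op A m N Y)"

definition residual ::
  "real^'n^'n \<Rightarrow> nat \<Rightarrow> (nat \<Rightarrow> real^'n^'n) \<Rightarrow> real^'r^'n \<Rightarrow> real^'n^'n \<Rightarrow> real^'n^'n" where
  "residual A m N B X = lyap A X + Pi_op m N X + B ** transpose B"

(* The complex number z = a + ib is an eigenvalue of the complexification of the
   real-linear operator T: the equation T(X + iY) = z (X + iY) with X + iY \<noteq> 0,
   split into real and imaginary parts. *)
definition complex_eigenvalue :: "('a::real_vector \<Rightarrow> 'a) \<Rightarrow> complex \<Rightarrow> bool" where
  "complex_eigenvalue T z \<longleftrightarrow>
     (\<exists>X Y. (X, Y) \<noteq> (0, 0) \<and>
        T X = Re z *\<^sub>R X - Im z *\<^sub>R Y \<and>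
        T Y = Im z *\<^sub>R X + Re z *\<^sub>R Y)"

(* Used for linear T on a nonzero finite-dimensional space, where the set is finite
   and nonempty, so that the supremum is a maximum. *)
definition op_spectral_radius :: "('a::real_vector \<Rightarrow> 'a) \<Rightarrow> real" where
  "op_spectral_radius T = Sup {cmod z | z. complex_eigenvalue T z}"

definition local_minimizer :: "('a::topological_space \<Rightarrow> real) \<Rightarrow> 'a \<Rightarrow> bool" where
  "local_minimizer f p \<longleftrightarrow> (\<forall>\<^sub>F q in nhds p. f p \<le> f q)"

(* The objective J_k, with the residual R_k as the argument R. *)
definition J_fun ::
  "real^'n^'n \<Rightarrow> nat \<Rightarrow> (nat \<Rightarrow> real^'n^'n) \<Rightarrow> real^'n^'n \<Rightarrow> (real^'n) \<times> (real^'n) \<Rightarrow> real" where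
  "J_fun A m N R = (\<lambda>(v, w).
     M_inner A m N (outer v w) (outer v w) - 2 * trace (outer w v ** R))"

end

theory Submission
  imports Defs
begin

text \<open>
  Write \<open>R\<close> for the residual at one step and \<open>v\<close> for the next vector. Stationarity of \<open>J\<close> in its
  first argument alone gives
  \<open>-|v|\<^sup>2 A v - (v\<^sup>T A v) v - \<Sum>\<^sub>i (v\<^sup>T N\<^sub>i v) N\<^sub>i v = R v\<close>. Eliminating \<open>A v\<close> from the updated residual
  by this relation yields, for \<open>v \<noteq> 0\<close> and \<open>P = I - v v\<^sup>T / |v|\<^sup>2\<close>,
  \<open>R + A v v\<^sup>T + v v\<^sup>T A + \<Sum>\<^sub>i N\<^sub>i v v\<^sup>T N\<^sub>i = P R P + \<Sum>\<^sub>i (P N\<^sub>i v) (P N\<^sub>i v)\<^sup>T\<close>,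
  so positive semidefiniteness passes from each step to the next.
\<close>

lemma transpose_add: "transpose (X + Y) = transpose X + transpose Y"
  by (simp add: transpose_def vec_eq_iff)

lemma transpose_sum: "transpose (sum f S) = (\<Sum>i\<in>S. transpose (f i))"
  by (simp add: transpose_def vec_eq_iff)

lemma sum_matrix_vector_mult:
  fixes f :: "'i \<Rightarrow> real^'n^'m"
  shows "sum f S *v x = (\<Sum>i\<in>S. f i *v x)"
  by (induction S rule: infinite_finite_induct) (simp_all add: matrix_vector_mult_add_rdistrib)

lemma matrix_add_rdistrib:
  fixes X Y :: "real^'n^'m"
  shows "(X + Y) ** Z = X ** Z + Y ** Z"
  by (simp add: matrix_matrix_mult_def vec_eq_iff sum.distrib algebra_simps)

lemma matrix_vector_mult_minus_left:
  fixes X :: "real^'n^'m"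
  shows "(- X) *v x = - (X *v x)"
  by (simp add: matrix_vector_mult_def vec_eq_iff sum_negf)

lemma inner_matrix_vector_mult_symmetric:
  assumes "symmetric_matrix X"
  shows "x \<bullet> (X *v y) = y \<bullet> (X *v x)"
  by (metis assms dot_lmul_matrix inner_commute symmetric_matrix_def transpose_matrix_vector)

lemma transpose_outer: "transpose (outer v w) = outer w v"
  by (simp add: transpose_def outer_def vec_eq_iff mult.commute)

lemma outer_matrix_vector_mult: "outer v w *v x = (w \<bullet> x) *\<^sub>R v"
  by (simp add: outer_def matrix_vector_mult_def inner_vec_def vec_eq_iff sum_distrib_left
      mult_ac)

lemma matrix_mult_outer: "X ** outer v w = outer (X *v v) w"
  by (simp add: outer_def matrix_vector_mult_def matrix_matrix_mult_def vec_eq_iff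
      sum_distrib_left mult_ac)

lemma outer_matrix_mult_transpose: "outer v w ** transpose X = outer v (X *v w)"
  by (simp add: outer_def matrix_vector_mult_def matrix_matrix_mult_def transpose_def vec_eq_iff
      sum_distrib_left mult_ac)

lemma trace_outer_mult: "trace (outer w v ** Y) = v \<bullet> (Y *v w)"
  unfolding trace_def outer_def matrix_vector_mult_def matrix_matrix_mult_def inner_vec_def
  by (simp add: sum_distrib_left mult_ac) (rule sum.swap)

lemma lyap_outer: "lyap A (outer v w) = outer (A *v v) w + outer v (A *v w)"
  by (simp add: lyap_def matrix_mult_outer outer_matrix_mult_transpose)

lemma Pi_op_outer: "Pi_op m N (outer v w) = (\<Sum>i=1..m. outer (N i *v v) (N i *v w))"
  by (simp add: Pi_op_def matrix_mult_outer outer_matrix_mult_transpose)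

lemma lyap_add: "lyap A (X + Y) = lyap A X + lyap A Y"
  by (simp add: lyap_def matrix_add_ldistrib matrix_add_rdistrib)

lemma Pi_op_add: "Pi_op m N (X + Y) = Pi_op m N X + Pi_op m N Y"
  by (simp add: Pi_op_def matrix_add_ldistrib matrix_add_rdistrib sum.distrib)

text \<open>By linearity of \<open>lyap\<close> and \<open>Pi_op\<close> the constant term
  \<open>B ** transpose B\<close> stays inside the old residual, so the increment depends only on
  \<open>v\<close>.\<close>

lemma residual_add_outer:
  "residual A m N B (X + outer v v) = residual A m N B X
     + (outer (A *v v) v + outer v (A *v v) + (\<Sum>i=1..m. outer (N i *v v) (N i *v v)))"
  by (simp add: residual_def lyap_add Pi_op_add lyap_outer Pi_op_outer)

lemma residual_zero: "residual A m N B 0 = B ** transpose B"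
  by (simp add: residual_def lyap_def Pi_op_def)

text \<open>On rank-one arguments every trace factors into products of bilinear forms, so for fixed
  \<open>w\<close> the objective is a quadratic polynomial in \<open>v\<close>.\<close>

lemma J_fun_eq:
  "J_fun A m N R (v, w) = - (v \<bullet> (A *v v)) * (w \<bullet> w) - (v \<bullet> v) * (w \<bullet> (A *v w))
     - (\<Sum>i=1..m. (v \<bullet> (N i *v v)) * (w \<bullet> (N i *v w))) - 2 * (v \<bullet> (R *v w))"
  unfolding J_fun_def M_inner_def M_op_def
  by (simp add: transpose_outer trace_outer_mult lyap_outer Pi_op_outer
      matrix_vector_mult_diff_rdistrib matrix_vector_mult_add_rdistrib sum_matrix_vector_mult
      outer_matrix_vector_mult inner_diff_right inner_add_right inner_sum_right
      matrix_vector_mult_minus_left inner_commute mult.commute)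

text \<open>Along the line \<open>v + t *\<^sub>R u\<close>, with \<open>w\<close> fixed, the
  objective is a quadratic polynomial in \<open>t\<close> whose linear coefficient vanishes at a
  local minimum. The direction \<open>u\<close> is arbitrary, so this is the stationarity equation
  in weak form.\<close>

lemma J_fun_stationary:
  assumes A: "symmetric_matrix A"
    and N: "\<And>i. i \<in> {1..m} \<Longrightarrow> symmetric_matrix (N i)"
    and opt: "local_minimizer (J_fun A m N R) (v, w)"
  shows "- (u \<bullet> (A *v v)) * (w \<bullet> w) - (u \<bullet> v) * (w \<bullet> (A *v w))
     - (\<Sum>i=1..m. (u \<bullet> (N i *v v)) * (w \<bullet> (N i *v w))) = u \<bullet> (R *v w)"
    (is "?L = _")
proof -
  define f where "f t = J_fun A m N R (v + t *\<^sub>R u, w)" for t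
  \<comment> \<open>\<open>a\<close> and \<open>b\<close> are the coefficients of
    \<open>t\<^sup>2\<close> and \<open>t\<close> in \<open>f t\<close>. Symmetry of
    \<open>A\<close> and \<open>N i\<close> merges the two cross terms of each quadratic form, which
    gives the factor 2 in \<open>b\<close>.\<close>
  define a where "a = - (u \<bullet> (A *v u)) * (w \<bullet> w) - (u \<bullet> u) * (w \<bullet> (A *v w))
     - (\<Sum>i=1..m. (u \<bullet> (N i *v u)) * (w \<bullet> (N i *v w)))"
  define b where "b = 2 * (?L - u \<bullet> (R *v w))"
  have quad: "(v + t *\<^sub>R u) \<bullet> (X *v (v + t *\<^sub>R u))
      = v \<bullet> (X *v v) + t * (2 * (u \<bullet> (X *v v))) + t\<^sup>2 * (u \<bullet> (X *v u))"
    if "symmetric_matrix X" for X t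
    using inner_matrix_vector_mult_symmetric[OF that, of v u]
    by (simp add: matrix_vector_right_distrib matrix_vector_mult_scaleR inner_add_left
        inner_add_right power2_eq_square algebra_simps)
  have quad1: "(v + t *\<^sub>R u) \<bullet> (v + t *\<^sub>R u) = v \<bullet> v + t * (2 * (u \<bullet> v)) + t\<^sup>2 * (u \<bullet> u)" for t
    by (simp add: inner_add_left inner_add_right inner_commute power2_eq_square algebra_simps)
  have sumN: "(\<Sum>i=1..m. ((v + t *\<^sub>R u) \<bullet> (N i *v (v + t *\<^sub>R u))) * (w \<bullet> (N i *v w)))
      = (\<Sum>i=1..m. (v \<bullet> (N i *v v)) * (w \<bullet> (N i *v w)))
        + t * (2 * (\<Sum>i=1..m. (u \<bullet> (N i *v v)) * (w \<bullet> (N i *v w))))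
        + t\<^sup>2 * (\<Sum>i=1..m. (u \<bullet> (N i *v u)) * (w \<bullet> (N i *v w)))" for t
    unfolding sum_distrib_left sum.distrib[symmetric]
    by (intro sum.cong refl, subst quad[OF N], assumption) (simp add: algebra_simps)
  have f_eq: "f = (\<lambda>t. J_fun A m N R (v, w) + b * t + a * t\<^sup>2)"
    unfolding f_def J_fun_eq quad[OF A] quad1 sumN a_def b_def
    by (rule ext) (simp add: inner_add_left algebra_simps)
  have "(f has_real_derivative b) (at 0)"
    unfolding f_eq by (auto intro!: derivative_eq_intros)
  \<comment> \<open>Continuity of the line carries the minimality over pairs back to a statement
    about small \<open>t\<close>.\<close>
  moreover have "((\<lambda>t. (v + t *\<^sub>R u, w)) \<longlongrightarrow> (v + 0 *\<^sub>R u, w)) (at 0)"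
    by (intro tendsto_intros)
  then have "\<forall>\<^sub>F t in at 0. J_fun A m N R (v, w) \<le> f t"
    unfolding f_def
    using opt eventually_compose_filterlim[of "\<lambda>q. J_fun A m N R (v, w) \<le> J_fun A m N R q"]
    by (simp add: local_minimizer_def)
  \<comment> \<open>The filter \<open>at 0\<close> leaves out the point 0 itself, where the
    inequality is trivial.\<close>
  then have "\<forall>\<^sub>F t in nhds 0. f 0 \<le> f t"
    by (simp add: eventually_nhds_conv_at f_def)
  then obtain d where "d > 0" "\<And>t. dist t 0 < d \<Longrightarrow> f 0 \<le> f t"
    unfolding eventually_nhds_metric by blast
  ultimately have "b = 0"
    by (intro DERIV_local_min[of f b 0 d]) (auto simp: dist_real_def)
  then show ?thesis
    by (simp add: b_def)
qed

text \<open>Stationarity turns the new quadratic form at \<open>x\<close> into the old one at the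
  projection of \<open>x\<close> onto the complement of \<open>v\<close>, plus a sum of
  squares.\<close>

lemma loewner_le_zero_update:
  assumes R: "loewner_le 0 R"
    and stationary: "\<And>u. - (u \<bullet> (A *v v)) * (v \<bullet> v) - (u \<bullet> v) * (v \<bullet> (A *v v))
     - (\<Sum>i=1..m. (u \<bullet> (N i *v v)) * (v \<bullet> (N i *v v))) = u \<bullet> (R *v v)"
  shows "loewner_le 0 (R + (outer (A *v v) v + outer v (A *v v)
    + (\<Sum>i=1..m. outer (N i *v v) (N i *v v))))" (is "loewner_le 0 ?R'")
proof -
  have sym: "symmetric_matrix R" and pos: "\<And>x. 0 \<le> x \<bullet> (R *v x)"
    using R by (auto simp: loewner_le_def)
  have sym': "symmetric_matrix ?R'"
    using sym unfolding symmetric_matrix_def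
    by (simp add: transpose_add transpose_sum transpose_outer)
  have "0 \<le> x \<bullet> (?R' *v x)" for x
  proof (cases "v = 0")
    \<comment> \<open>There is no direction to project along here, but the increment
      vanishes.\<close>
    case True
    then show ?thesis
      using pos by (simp add: outer_def flip: zero_vec_def)
  next
    case False
    define s where "s = v \<bullet> v"
    \<comment> \<open>This coefficient makes \<open>y\<close> orthogonal to \<open>v\<close>, so
      \<open>y\<close> is the projection \<open>P x\<close>.\<close>
    define c where "c = (v \<bullet> x) / s"
    define y where "y = x - c *\<^sub>R v"
    define n where "n i = v \<bullet> (N i *v v)" for i
    define p where "p i = x \<bullet> (N i *v v)" for i
    have s: "s \<noteq> 0" using False by (simp add: s_def)
    have vx: "v \<bullet> x = c * s" using s by (simp add: c_def)
    have lhs: "x \<bullet> (?R' *v x) = x \<bullet> (R *v x) + 2 * (c * s) * (x \<bullet> (A *v v)) + (\<Sum>i=1..m. (p i)\<^sup>2)"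
      by (simp add: matrix_vector_mult_add_rdistrib sum_matrix_vector_mult
          outer_matrix_vector_mult inner_add_right inner_sum_right vx p_def inner_commute
          power2_eq_square mult_ac)
    \<comment> \<open>Testing with \<open>u = x\<close> eliminates \<open>A *v v\<close> paired with
      \<open>x\<close> but leaves it paired with \<open>v\<close>; testing with \<open>u = v\<close>
      then removes that as well.\<close>
    have ex: "s * (x \<bullet> (A *v v)) = - (x \<bullet> (R *v v)) - c * s * (v \<bullet> (A *v v)) - (\<Sum>i=1..m. p i * n i)"
      using stationary[of x] vx by (simp add: s_def n_def p_def inner_commute mult_ac)
    have ev: "2 * s * (v \<bullet> (A *v v)) = - (v \<bullet> (R *v v)) - (\<Sum>i=1..m. (n i)\<^sup>2)"
      using stationary[of v] by (simp add: s_def n_def power2_eq_square mult_ac)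
    have "2 * (c * s) * (x \<bullet> (A *v v)) = 2 * c * (s * (x \<bullet> (A *v v)))"
      by simp
    also have "\<dots> = - 2 * c * (x \<bullet> (R *v v)) - c\<^sup>2 * (2 * s * (v \<bullet> (A *v v)))
        - 2 * c * (\<Sum>i=1..m. p i * n i)"
      unfolding ex by (simp add: algebra_simps power2_eq_square)
    also have "\<dots> = - 2 * c * (x \<bullet> (R *v v)) + c\<^sup>2 * (v \<bullet> (R *v v)) + c\<^sup>2 * (\<Sum>i=1..m. (n i)\<^sup>2)
        - 2 * c * (\<Sum>i=1..m. p i * n i)"
      unfolding ev by (simp add: algebra_simps)
    finally have mid: "2 * (c * s) * (x \<bullet> (A *v v)) = \<dots>" .
    have yRy: "y \<bullet> (R *v y) = x \<bullet> (R *v x) - 2 * c * (x \<bullet> (R *v v)) + c\<^sup>2 * (v \<bullet> (R *v v))"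
      using inner_matrix_vector_mult_symmetric[OF sym, of v x]
      by (simp add: y_def matrix_vector_mult_diff_distrib matrix_vector_mult_scaleR
          inner_diff_left inner_diff_right power2_eq_square algebra_simps)
    \<comment> \<open>Each \<open>p i - c * n i\<close> is the inner product of \<open>y\<close>
      with \<open>N i *v v\<close>, equivalently of \<open>x\<close> with
      \<open>P N i v\<close>.\<close>
    have "(\<Sum>i=1..m. (p i - c * n i)\<^sup>2) = (\<Sum>i=1..m. (p i)\<^sup>2) - 2 * c * (\<Sum>i=1..m. p i * n i)
        + c\<^sup>2 * (\<Sum>i=1..m. (n i)\<^sup>2)"
      unfolding sum_distrib_left sum.distrib[symmetric] sum_subtractf[symmetric]
      by (rule sum.cong) (simp_all add: power2_eq_square algebra_simps)
    then have "x \<bullet> (?R' *v x) = y \<bullet> (R *v y) + (\<Sum>i=1..m. (p i - c * n i)\<^sup>2)"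
      unfolding lhs mid yRy by simp
    then show ?thesis
      using pos[of y] by (simp add: sum_nonneg)
  qed
  then show ?thesis
    using sym' R by (simp add: loewner_le_def)
qed

lemma loewner_le_zero_mult_transpose: "loewner_le 0 (B ** transpose B)"
proof -
  have "x \<bullet> ((B ** transpose B) *v x) = (transpose B *v x) \<bullet> (transpose B *v x)" for x
    by (metis dot_lmul_matrix matrix_vector_mul_assoc transpose_matrix_vector)
  moreover have "symmetric_matrix (0 :: real^'n^'n)"
    by (simp add: symmetric_matrix_def transpose_def vec_eq_iff)
  ultimately show ?thesis
    by (simp add: loewner_le_def symmetric_matrix_def matrix_transpose_mul)
qed

theorem theorem3p1:
  fixes A :: "real^'n^'n" and m :: nat and N :: "nat \<Rightarrow> real^'n^'n"
    and B :: "real^'r^'n"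
    and Xhat :: "nat \<Rightarrow> real^'n^'n" and v :: "nat \<Rightarrow> real^'n"
  assumes A_sym: "symmetric_matrix A"
    and N_sym: "\<And>i. i \<in> {1..m} \<Longrightarrow> symmetric_matrix (N i)"
    and A_neg: "loewner_less A 0"
    and rho: "op_spectral_radius (inv (lyap A) \<circ> Pi_op m N) < 1"
    and X0: "Xhat 0 = 0"
    and X_Suc: "\<And>k. Xhat (Suc k) = Xhat k + outer (v (Suc k)) (v (Suc k))"
    and v_opt: "\<And>k. local_minimizer (J_fun A m N (residual A m N B (Xhat k)))
                        (v (Suc k), v (Suc k))"
  shows "\<forall>k. residual A m N B (Xhat k) = transpose (residual A m N B (Xhat k)) \<and>
             loewner_le 0 (residual A m N B (Xhat k))"
proof
  fix k
  have "loewner_le 0 (residual A m N B (Xhat k))"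
  proof (induction k)
    case 0
    show ?case by (simp only: X0 residual_zero loewner_le_zero_mult_transpose)
  next
    case (Suc k)
    show ?case
      unfolding X_Suc residual_add_outer
      \<comment> \<open>Stationarity in the first argument is used at the diagonal point, where both
        arguments equal \<open>v (Suc k)\<close>.\<close>
      by (rule loewner_le_zero_update[OF Suc.IH J_fun_stationary[OF A_sym N_sym v_opt]])
  qed
  then show "residual A m N B (Xhat k) = transpose (residual A m N B (Xhat k)) \<and>
      loewner_le 0 (residual A m N B (Xhat k))"
    by (simp add: loewner_le_def symmetric_matrix_def)
qed

end
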